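(* The monads $\mathbb I_\omega=(I_\omega,\delta,\zeta)$ (idempotent measures of finite support) and $\mathbb J_\omega=(J_\omega,\delta,\xi)$ (max-min measures of finite support) in the category $\mathrm{UMET}$ of ultrametric spaces and nonexpanding maps are not isomorphic, i.e. no natural isomorphism $I_\omega\to J_\omega$ is a morphism of monads from $\mathbb I_\omega$ to $\mathbb J_\omega$.
   Context: $\mathrm{UMET}$ is the category of ultrametric spaces and nonexpanding maps. On $\bar{\mathbb R}=\mathbb R\cup\{-\infty,\infty\}$, $\vee$ is maximum, $\wedge$ is minimum, and $\odot$ is addition, with $-\infty\odot x=-\infty$ for $x<\infty$. $C(X)$ is the set of continuous real-valued functions on $X$. $J_\omega(X)$ is the set of functionals $\vee_{i=1}^n\alpha_i\wedge\delta_{x_i}\colon C(X)\to\mathbb R$, $\varphi\mapsto\vee_{i}(\alpha_i\wedge\varphi(x_i))$, where $x_i\in X$, $\alpha_i\in\bar{\mathbb R}$, $\vee_i\alpha_i=\infty$. $I_\omega(X)$ is the set of functionals $\vee_{i=1}^n\alpha_i\odot\delta_{x_i}\colon C(X)\to\mathbb R$, $\varphi\mapsto\vee_i(\alpha_i\odot\varphi(x_i))$, where $x_i\in X$, $\alpha_i\in[-\infty,0]$, $\vee_i\alpha_i=0$. In both, $\delta_x$ is the functional $\varphi\mapsto\varphi(x)$. For an ultrametric space $(X,d)$ and $r>0$, $O_r(x)=\{y\mid d(x,y)<r\}$ and $\mathcal F_r(X)$ is the set of functions $X\to\mathbb R$ constant on each $O_r(x)$. Both $J_\omega(X)$ and $I_\omega(X)$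 carry the ultrametric $\hat d(\mu,\nu)=\inf\{r>0\mid\mu(\varphi)=\nu(\varphi)\text{ for all }\varphi\in\mathcal F_r(X)\}$. On morphisms: $J_\omega(f)(\vee_i\alpha_i\wedge\delta_{x_i})=\vee_i\alpha_i\wedge\delta_{f(x_i)}$, $I_\omega(f)(\vee_i\alpha_i\odot\delta_{x_i})=\vee_i\alpha_i\odot\delta_{f(x_i)}$. Both units are $x\mapsto\delta_x$. Multiplications: $\xi_X\colon J_\omega^2(X)\to J_\omega(X)$ sends $\vee_i\alpha_i\wedge\delta_{\mu_i}$ with $\mu_i=\vee_j\beta_{ij}\wedge\delta_{x_{ij}}$ to $\vee_i\vee_j(\alpha_i\wedge\beta_{ij})\wedge\delta_{x_{ij}}$; $\zeta_X\colon I_\omega^2(X)\to I_\omega(X)$ sends $\vee_i\alpha_i\odot\delta_{\mu_i}$ with $\mu_i=\vee_j\beta_{ij}\odot\delta_{x_{ij}}$ to $\vee_i\vee_j(\alpha_i\odot\beta_{ij})\odot\delta_{x_{ij}}$. A morphism of monads $(T,\eta,\mu)\to(T',\eta',\mu')$ is a natural transformation $\alpha\colon T\to T'$ with $\alpha\circ\eta=\eta'$ and $\mu'\circ T'(\alpha)\circ\alpha_T=\alpha\circ\mu$. *)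

theory Defs
  imports "HOL-Analysis.Analysis"
begin

text \<open>
  The category UMET over a universe \<^typ>\<open>'u\<close>: its objects are the ultrametric spaces whose
  points are of type \<^typ>\<open>'u\<close>, and its morphisms are the nonexpanding maps, two maps being the
  same morphism if they agree on the points of the domain. When the universe has at least the
  cardinality of the continuum, this category is closed, up to isometry, under forming spaces of
  measures of finite support.
\<close>

definition ultrametric :: "'u metric \<Rightarrow> bool" where
  "ultrametric X \<longleftrightarrow>
     (\<forall>x\<in>mspace X. \<forall>y\<in>mspace X. \<forall>z\<in>mspace X. mdist X x z \<le> max (mdist X x y) (mdist X y z))"

definition nonexpanding :: "'u metric \<Rightarrow> 'u metric \<Rightarrow> ('u \<Rightarrow> 'u) \<Rightarrow> bool" where
  "nonexpanding X Y f \<longleftrightarrow>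
     f \<in> mspace X \<rightarrow> mspace Y \<and>
     (\<forall>x\<in>mspace X. \<forall>y\<in>mspace X. mdist Y (f x) (f y) \<le> mdist X x y)"

definition umet_isomorphism :: "'u metric \<Rightarrow> 'u metric \<Rightarrow> ('u \<Rightarrow> 'u) \<Rightarrow> bool" where
  "umet_isomorphism X Y f \<longleftrightarrow> nonexpanding X Y f \<and>
     (\<exists>g. nonexpanding Y X g \<and> (\<forall>x\<in>mspace X. g (f x) = x) \<and> (\<forall>y\<in>mspace Y. f (g y) = y))"

text \<open>The data of a monad on UMET; \<open>arr T X Y f\<close> is the value of the functor on \<open>f : X \<rightarrow> Y\<close>.\<close>

record 'u umet_monad =
  obj :: "'u metric \<Rightarrow> 'u metric"
  arr :: "'u metric \<Rightarrow> 'u metric \<Rightarrow> ('u \<Rightarrow> 'u) \<Rightarrow> 'u \<Rightarrow> 'u"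
  unit :: "'u metric \<Rightarrow> 'u \<Rightarrow> 'u"
  mult :: "'u metric \<Rightarrow> 'u \<Rightarrow> 'u"

definition natural_transformation ::
    "'u umet_monad \<Rightarrow> 'u umet_monad \<Rightarrow> ('u metric \<Rightarrow> 'u \<Rightarrow> 'u) \<Rightarrow> bool" where
  "natural_transformation S T \<alpha> \<longleftrightarrow>
     (\<forall>X. ultrametric X \<longrightarrow> nonexpanding (obj S X) (obj T X) (\<alpha> X)) \<and>
     (\<forall>X Y f. ultrametric X \<longrightarrow> ultrametric Y \<longrightarrow> nonexpanding X Y f \<longrightarrow>
        (\<forall>m\<in>mspace (obj S X). \<alpha> Y (arr S X Y f m) = arr T X Y f (\<alpha> X m)))"

definition natural_isomorphism ::
    "'u umet_monad \<Rightarrow> 'u umet_monad \<Rightarrow> ('u metric \<Rightarrow> 'u \<Rightarrow> 'u) \<Rightarrow> bool" where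
  "natural_isomorphism S T \<alpha> \<longleftrightarrow> natural_transformation S T \<alpha> \<and>
     (\<forall>X. ultrametric X \<longrightarrow> umet_isomorphism (obj S X) (obj T X) (\<alpha> X))"

definition monad_morphism ::
    "'u umet_monad \<Rightarrow> 'u umet_monad \<Rightarrow> ('u metric \<Rightarrow> 'u \<Rightarrow> 'u) \<Rightarrow> bool" where
  "monad_morphism S T \<alpha> \<longleftrightarrow> natural_transformation S T \<alpha> \<and>
     (\<forall>X. ultrametric X \<longrightarrow> (\<forall>x\<in>mspace X. \<alpha> X (unit S X x) = unit T X x)) \<and>
     (\<forall>X. ultrametric X \<longrightarrow> (\<forall>m\<in>mspace (obj S (obj S X)).
        mult T X (arr T (obj S X) (obj T X) (\<alpha> X) (\<alpha> (obj S X) m)) = \<alpha> X (mult S X m)))"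

text \<open>
  \<open>C(X)\<close> and \<open>F\<^sub>r(X)\<close>. Functions on \<open>X\<close> are represented by functions on the whole type, whose
  values outside \<open>X\<close> are irrelevant.
\<close>

definition cont_funs :: "'u metric \<Rightarrow> ('u \<Rightarrow> real) set" where
  "cont_funs X = {\<phi>. continuous_map (mtopology_of X) euclidean \<phi>}"

definition ball_const_funs :: "'u metric \<Rightarrow> real \<Rightarrow> ('u \<Rightarrow> real) set" where
  "ball_const_funs X r = {\<phi>. \<forall>x\<in>mspace X. \<forall>y\<in>mball_of X x r. \<phi> y = \<phi> x}"

text \<open>
  The measures \<open>\<Or>\<^sub>i \<alpha>\<^sub>i \<star> \<delta>\<^bsub>x\<^sub>i\<^esub>\<close> of finite support, for an operation \<open>\<star>\<close> and a value \<open>e\<close> of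
  \<open>\<Or>\<^sub>i \<alpha>\<^sub>i\<close>. A list of pairs \<open>(\<alpha>\<^sub>i, x\<^sub>i)\<close> presents such a measure. For \<open>\<star> = +\<close> and \<open>e = 0\<close> all
  coefficients lie in \<open>[-\<infinity>, 0]\<close>; for \<open>\<star> = min\<close> and \<open>e = \<infinity>\<close> they are arbitrary. In both cases
  the maximum below is finite, so that \<^const>\<open>real_of_ereal\<close> loses nothing.
\<close>

type_synonym 'u functional = "('u \<Rightarrow> real) \<Rightarrow> real"

definition presentations :: "ereal \<Rightarrow> 'u metric \<Rightarrow> (ereal \<times> 'u) list set" where
  "presentations e X =
     {ps. ps \<noteq> [] \<and> snd ` set ps \<subseteq> mspace X \<and> Max (fst ` set ps) = e}"

definition measure_of_pres ::
    "(ereal \<Rightarrow> ereal \<Rightarrow> ereal) \<Rightarrow> 'u metric \<Rightarrow> (ereal \<times> 'u) list \<Rightarrow> 'u functional" where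
  "measure_of_pres star X ps =
     (\<lambda>\<phi>\<in>cont_funs X. real_of_ereal (Max ((\<lambda>(a, x). star a (ereal (\<phi> x))) ` set ps)))"

definition fin_measures ::
    "(ereal \<Rightarrow> ereal \<Rightarrow> ereal) \<Rightarrow> ereal \<Rightarrow> 'u metric \<Rightarrow> 'u functional set" where
  "fin_measures star e X = measure_of_pres star X ` presentations e X"

definition dirac :: "'u metric \<Rightarrow> 'u \<Rightarrow> 'u functional" where
  "dirac X x = (\<lambda>\<phi>\<in>cont_funs X. \<phi> x)"

definition dhat :: "'u metric \<Rightarrow> 'u functional \<Rightarrow> 'u functional \<Rightarrow> real" where
  "dhat X \<mu> \<nu> = Inf {r. r > 0 \<and> (\<forall>\<phi>\<in>ball_const_funs X r. \<mu> \<phi> = \<nu> \<phi>)}"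

text \<open>
  To obtain an endofunctor of UMET over \<^typ>\<open>'u\<close>, the functionals are named by elements of \<^typ>\<open>'u\<close>,
  through an arbitrary injection. One exists as soon as \<^typ>\<open>'u\<close> has at least the
  cardinality of the continuum; up to isometry the construction does not depend on the injection.
\<close>

definition code :: "'b set \<Rightarrow> 'b \<Rightarrow> 'u" where
  "code A = (SOME c. inj_on c A)"

definition decode :: "'b set \<Rightarrow> 'u \<Rightarrow> 'b" where
  "decode A = inv_into A (code A)"

definition meas_obj ::
    "(ereal \<Rightarrow> ereal \<Rightarrow> ereal) \<Rightarrow> ereal \<Rightarrow> 'u metric \<Rightarrow> 'u metric" where
  "meas_obj star e X =
     (let A = fin_measures star e X; P = code A ` A in
      metric (P, \<lambda>p q. if p \<in> P \<and> q \<in> P then dhat X (decode A p) (decode A q) else 0))"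

text \<open>
  The point named by a presentation, and some presentation of a given point. The functor and the
  multiplication are defined on presentations; in both instances below the result does not depend
  on the presentations chosen.
\<close>

definition pt ::
    "(ereal \<Rightarrow> ereal \<Rightarrow> ereal) \<Rightarrow> ereal \<Rightarrow> 'u metric \<Rightarrow> (ereal \<times> 'u) list \<Rightarrow> 'u" where
  "pt star e X ps = code (fin_measures star e X) (measure_of_pres star X ps)"

definition pres ::
    "(ereal \<Rightarrow> ereal \<Rightarrow> ereal) \<Rightarrow> ereal \<Rightarrow> 'u metric \<Rightarrow> 'u \<Rightarrow> (ereal \<times> 'u) list" where
  "pres star e X p = (SOME ps. ps \<in> presentations e X \<and> pt star e X ps = p)"

definition meas_arr ::
    "(ereal \<Rightarrow> ereal \<Rightarrow> ereal) \<Rightarrow> ereal \<Rightarrow>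
     'u metric \<Rightarrow> 'u metric \<Rightarrow> ('u \<Rightarrow> 'u) \<Rightarrow> 'u \<Rightarrow> 'u" where
  "meas_arr star e X Y f p = pt star e Y (map (\<lambda>(a, x). (a, f x)) (pres star e X p))"

definition meas_unit ::
    "(ereal \<Rightarrow> ereal \<Rightarrow> ereal) \<Rightarrow> ereal \<Rightarrow> 'u metric \<Rightarrow> 'u \<Rightarrow> 'u" where
  "meas_unit star e X x = code (fin_measures star e X) (dirac X x)"

definition meas_mult ::
    "(ereal \<Rightarrow> ereal \<Rightarrow> ereal) \<Rightarrow> ereal \<Rightarrow> 'u metric \<Rightarrow> 'u \<Rightarrow> 'u" where
  "meas_mult star e X p =
     pt star e X (concat (map (\<lambda>(a, m). map (\<lambda>(b, x). (star a b, x)) (pres star e X m))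
       (pres star e (meas_obj star e X) p)))"

definition meas_monad ::
    "(ereal \<Rightarrow> ereal \<Rightarrow> ereal) \<Rightarrow> ereal \<Rightarrow> 'u umet_monad" where
  "meas_monad star e =
     \<lparr>obj = meas_obj star e, arr = meas_arr star e, unit = meas_unit star e, mult = meas_mult star e\<rparr>"

definition I_monad :: "'u umet_monad" where
  "I_monad = meas_monad (+) 0"

definition J_monad :: "'u umet_monad" where
  "J_monad = meas_monad min \<infinity>"

end

theory Submission
  imports Defs
begin

text \<open>
  On a two-point space \<open>X = {x, y}\<close> take \<open>\<mu> = 0 \<odot> \<delta>\<^sub>x \<or> (-1) \<odot> \<delta>\<^sub>y\<close> and \<open>f : X \<rightarrow> I(X)\<close> with
  \<open>f x = \<delta>\<^sub>x\<close>, \<open>f y = \<mu>\<close>. Then \<open>\<zeta> (I f \<mu>) = 0 \<odot> \<delta>\<^sub>x \<or> (-2) \<odot> \<delta>\<^sub>y\<close> differs from \<open>\<mu>\<close>. A morphism of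
  monads \<open>\<alpha>\<close> sends it to \<open>\<xi> (J (\<alpha> f) \<nu>)\<close>, where \<open>\<nu> = \<alpha> \<mu>\<close>, \<open>\<alpha> f x = \<delta>\<^sub>x\<close> and \<open>\<alpha> f y = \<nu>\<close>.
  Since the minimum is idempotent, this is \<open>\<nu>\<close> again, whatever its coefficients are, so \<open>\<alpha>\<close> is not
  injective. All spaces that occur have distances 0 and 1 only, which makes every function on them
  continuous.
\<close>

section \<open>Coding of measures\<close>

lemma square_lepoll_infinite:
  assumes "infinite A"
  shows "A \<times> A \<lesssim> A"
proof -
  include cardinal_syntax
  have "|A \<times> A| \<le>o |A|"
    using card_of_Times_same_infinite[OF assms] ordIso_iff_ordLeq by blast
  then show ?thesis
    by (simp add: card_of_ordLeq[symmetric] lepoll_def)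
qed

lemma foldr_pairing_inj:
  assumes "inj g" "length xs = length ys"
    and "foldr (\<lambda>x z. g (x, z)) xs c = foldr (\<lambda>x z. g (x, z)) ys c"
  shows "xs = ys"
  using assms(2,3)
proof (induction rule: list_induct2)
  case (Cons x xs y ys)
  then show ?case
    using injD[OF assms(1)] by fastforce
qed simp

lemma lists_lepoll_infinite:
  assumes "infinite (UNIV :: 'a set)"
  shows "(UNIV :: 'a list set) \<lesssim> (UNIV :: 'a set)"
proof -
  obtain g :: "'a \<times> 'a \<Rightarrow> 'a" where g: "inj g"
    using square_lepoll_infinite[OF assms] by (auto simp: lepoll_def simp flip: UNIV_Times_UNIV)
  obtain n :: "nat \<Rightarrow> 'a" where n: "inj n"
    using assms unfolding infinite_le_lepoll lepoll_def by blast
  \<comment> \<open>Folding from the fixed seed \<open>n 0\<close> need not separate lists of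
    different lengths, so the length is recorded as well; \<open>foldr_pairing_inj\<close> then
    recovers the entries.\<close>
  define h where "h xs = g (n (length xs), foldr (\<lambda>x z. g (x, z)) xs (n 0))" for xs
  have "inj h"
    unfolding h_def by (rule injI) (metis foldr_pairing_inj g injD n prod.inject)
  then show ?thesis
    by (auto simp: lepoll_def)
qed

text \<open>Adjoining two points to an infinite set does not change its cardinality.\<close>

lemma ereal_lepoll_real: "(UNIV :: ereal set) \<lesssim> (UNIV :: real set)"
proof -
  have 1: "(UNIV :: ereal set) = insert \<infinity> (insert (-\<infinity>) (range ereal))"
    using ereal_cases by blast
  have 2: "infinite (range ereal)"
    by (metis ereal.inject finite_imageD infinite_UNIV_char_0 injI)
  have "insert \<infinity> (insert (-\<infinity>) (range ereal)) \<approx> range ereal"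
    by (meson 2 eqpoll_trans finite_insert infinite_insert_eqpoll)
  then show ?thesis
    unfolding 1 by (metis eqpoll_imp_lepoll image_lepoll lepoll_trans)
qed

text \<open>The cardinality bound behind \<open>inj_on_code\<close>: measures are images of
  presentations, and an infinite universe absorbs squares and finite lists.\<close>

lemma presentations_lepoll:
  assumes universe: "(UNIV :: real set) \<lesssim> (UNIV :: 'u set)"
  shows "(UNIV :: (ereal \<times> 'u) list set) \<lesssim> (UNIV :: 'u set)"
proof -
  have inf: "infinite (UNIV :: 'u set)"
    using universe by (meson infinite_UNIV_char_0 lepoll_iff finite_surj)
  have "(UNIV :: ereal set) \<times> (UNIV :: 'u set) \<lesssim> (UNIV :: 'u set)"
    using times_lepoll_mono[OF lepoll_trans[OF ereal_lepoll_real universe] lepoll_refl]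
      square_lepoll_infinite[OF inf] by (rule lepoll_trans)
  then have "lists (UNIV :: (ereal \<times> 'u) set) \<lesssim> lists (UNIV :: 'u set)"
    by (intro lists_lepoll_mono) simp
  then show ?thesis
    using lists_lepoll_infinite[OF inf] by (simp add: lepoll_trans)
qed

text \<open>Since \<open>code\<close> is picked by \<open>SOME\<close>, everything rests on the
  existence of one injection of the measures into the universe.\<close>

lemma inj_on_code:
  assumes universe: "(UNIV :: real set) \<lesssim> (UNIV :: 'u set)"
  shows "inj_on (code (fin_measures star e X) :: _ \<Rightarrow> 'u) (fin_measures star e (X :: 'u metric))"
proof -
  have "fin_measures star e X \<lesssim> (UNIV :: (ereal \<times> 'u) list set)"
    unfolding fin_measures_def by (meson image_lepoll lepoll_trans subset_UNIV subset_imp_lepoll)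
  then have "fin_measures star e X \<lesssim> (UNIV :: 'u set)"
    by (rule lepoll_trans[OF _ presentations_lepoll[OF universe]])
  then have "\<exists>c :: _ \<Rightarrow> 'u. inj_on c (fin_measures star e X)"
    by (auto simp: lepoll_def)
  then show ?thesis
    unfolding code_def by (rule someI_ex)
qed

section \<open>Discrete spaces\<close>

text \<open>This class of spaces is stable under \<open>meas_obj\<close> (see
  \<open>meas_obj_discrete\<close>), and all maps between its members are nonexpanding, so
  naturality can be applied to any of them.\<close>

definition unit_discrete :: "'u metric \<Rightarrow> bool" where
  "unit_discrete X \<longleftrightarrow> (\<forall>x\<in>mspace X. \<forall>y\<in>mspace X. mdist X x y = (if x = y then 0 else 1))"

lemma unit_discrete_ultrametric: "unit_discrete X \<Longrightarrow> ultrametric X"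
  by (auto simp: unit_discrete_def ultrametric_def)

lemma unit_discrete_nonexpanding:
  "unit_discrete X \<Longrightarrow> unit_discrete Y \<Longrightarrow> f \<in> mspace X \<rightarrow> mspace Y \<Longrightarrow> nonexpanding X Y f"
  by (auto simp: unit_discrete_def nonexpanding_def Pi_iff)

text \<open>The locale \<open>Metric_space\<close> asks for symmetry and nonnegativity on the whole
  type, so \<open>d\<close> is given the value 0 off \<open>M\<close>.\<close>

lemma unit_discrete_metric:
  fixes d :: "'u \<Rightarrow> 'u \<Rightarrow> real"
  assumes d: "\<And>x y. d x y = (if x \<in> M \<and> y \<in> M \<and> x \<noteq> y then 1 else 0)"
  shows "mspace (metric (M, d)) = M" "unit_discrete (metric (M, d))"
proof -
  have "Metric_space M d"
    by unfold_locales (auto simp: d)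
  then show 1: "mspace (metric (M, d)) = M" "unit_discrete (metric (M, d))"
    by (simp_all add: Metric_space.mspace_metric Metric_space.mdist_metric unit_discrete_def d)
qed

text \<open>An open ball of radius 1 contains only its centre, so the topology is discrete.\<close>

lemma unit_discrete_cont_funs:
  assumes "unit_discrete X"
  shows "cont_funs X = UNIV"
proof -
  have "openin (mtopology_of X) U" if U: "U \<subseteq> mspace X" for U
    unfolding mtopology_of_def Metric_space.openin_mtopology[OF Metric_space_mspace_mdist]
  proof (intro conjI allI impI U)
    fix x assume "x \<in> U"
    with assms U show "\<exists>r>0. Metric_space.mball (mspace X) (mdist X) x r \<subseteq> U"
      by (intro exI[of _ 1])
        (fastforce simp: unit_discrete_def Metric_space.in_mball[OF Metric_space_mspace_mdist]
          split: if_splits)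
  qed
  then have "mtopology_of X = discrete_topology (mspace X)"
    by (metis discrete_topology_unique topspace_mtopology_of openin_subset)
  then show ?thesis
    by (simp add: cont_funs_def)
qed

section \<open>The functor and the multiplication on presentations\<close>

text \<open>Integrands and values are extended reals, so that an inner maximum can itself be
  integrated before its finiteness is known.\<close>

definition pres_max :: "(ereal \<Rightarrow> ereal \<Rightarrow> ereal) \<Rightarrow> (ereal \<times> 'u) list \<Rightarrow> ('u \<Rightarrow> ereal) \<Rightarrow> ereal" where
  "pres_max star ps \<psi> = Max ((\<lambda>(a, x). star a (\<psi> x)) ` set ps)"

lemma pres_max_le_iff:
  "ps \<noteq> [] \<Longrightarrow> pres_max star ps \<psi> \<le> u \<longleftrightarrow> (\<forall>(a, x)\<in>set ps. star a (\<psi> x) \<le> u)"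
  by (auto simp: pres_max_def)

lemma pres_max_map: "pres_max star (map (\<lambda>(a, x). (a, f x)) ps) \<psi> = pres_max star ps (\<psi> \<circ> f)"
proof -
  have "(\<lambda>(a, x). star a (\<psi> x)) ` set (map (\<lambda>(a, x). (a, f x)) ps)
      = (\<lambda>(a, x). star a ((\<psi> \<circ> f) x)) ` set ps"
    by (force simp: image_iff)
  then show ?thesis
    by (simp add: pres_max_def)
qed

lemma pres_max_cong:
  assumes "\<And>x. x \<in> snd ` set ps \<Longrightarrow> \<psi> x = \<psi>' x"
  shows "pres_max star ps \<psi> = pres_max star ps \<psi>'"
proof -
  have "(\<lambda>(a, x). star a (\<psi> x)) ` set ps = (\<lambda>(a, x). star a (\<psi>' x)) ` set ps"
    using assms by (intro image_cong) force+
  then show ?thesis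
    by (simp add: pres_max_def)
qed

text \<open>Kleisli extension on lists. The body of \<open>meas_mult\<close> is the case where
  \<open>g\<close> is \<open>pres star e X\<close>; a free \<open>g\<close> allows convenient
  presentations instead of chosen ones.\<close>

definition pres_bind ::
    "(ereal \<Rightarrow> ereal \<Rightarrow> ereal) \<Rightarrow> (ereal \<times> 'a) list \<Rightarrow> ('a \<Rightarrow> (ereal \<times> 'u) list) \<Rightarrow> (ereal \<times> 'u) list" where
  "pres_bind star ps g = concat (map (\<lambda>(a, z). map (\<lambda>(b, x). (star a b, x)) (g z)) ps)"

lemma measure_of_pres_discrete:
  "unit_discrete X \<Longrightarrow>
    measure_of_pres star X ps = (\<lambda>\<phi>. real_of_ereal (pres_max star ps (\<lambda>x. ereal (\<phi> x))))"
  by (simp add: measure_of_pres_def unit_discrete_cont_funs pres_max_def restrict_UNIV)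

lemma fin_measures_pres:
  "ps \<in> presentations e X \<Longrightarrow> measure_of_pres star X ps \<in> fin_measures star e X"
  by (simp add: fin_measures_def)

lemma presentations_map:
  assumes "ps \<in> presentations e X" "f \<in> mspace X \<rightarrow> mspace Y"
  shows "map (\<lambda>(a, x). (a, f x)) ps \<in> presentations e Y"
proof -
  have "fst ` set (map (\<lambda>(a, x). (a, f x)) ps) = fst ` set ps"
    by (force simp: image_iff)
  with assms show ?thesis
    by (fastforce simp: presentations_def)
qed

text \<open>The laws shared by addition with 0 and minimum with infinity, so that both functors and
  multiplications are treated at once.\<close>

locale coefficient_op =
  fixes star :: "ereal \<Rightarrow> ereal \<Rightarrow> ereal" and e :: ereal
  assumes assoc: "star (star a b) c = star a (star b c)"
    and star_mono: "a \<le> b \<Longrightarrow> c \<le> d \<Longrightarrow> star a c \<le> star b d"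
    and left_neutral: "star e a = a"
begin

lemma star_pres_max:
  assumes "ps \<noteq> []"
  shows "star a (pres_max star ps \<psi>) = pres_max (\<lambda>b c. star a (star b c)) ps \<psi>"
proof -
  have "mono (star a)"
    by (simp add: monoI star_mono)
  with assms show ?thesis
    unfolding pres_max_def by (subst mono_Max_commute) (auto simp: image_image case_prod_unfold)
qed

text \<open>The two maxima have the same upper bounds: \<open>star a\<close> distributes over the
  inner maximum by monotonicity, and associativity merges the coefficients.\<close>

lemma pres_max_bind:
  assumes "ps \<noteq> []" "\<And>z. z \<in> snd ` set ps \<Longrightarrow> g z \<noteq> []"
  shows "pres_max star (pres_bind star ps g) \<psi> = pres_max star ps (\<lambda>z. pres_max star (g z) \<psi>)"
proof -
  have ne: "pres_bind star ps g \<noteq> []"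
    using assms by (cases ps) (auto simp: pres_bind_def)
  have "pres_max star (pres_bind star ps g) \<psi> \<le> u \<longleftrightarrow>
      pres_max star ps (\<lambda>z. pres_max star (g z) \<psi>) \<le> u" for u
  proof -
    have "star a (pres_max star (g z) \<psi>) \<le> u \<longleftrightarrow> (\<forall>(b, x)\<in>set (g z). star (star a b) (\<psi> x) \<le> u)"
      if "(a, z) \<in> set ps" for a z
    proof -
      have "g z \<noteq> []"
        using that assms(2) by force
      then show ?thesis
        by (simp add: star_pres_max pres_max_le_iff assoc)
    qed
    then have "(\<forall>(a, z)\<in>set ps. star a (pres_max star (g z) \<psi>) \<le> u) \<longleftrightarrow>
        (\<forall>(a, z)\<in>set ps. \<forall>(b, x)\<in>set (g z). star (star a b) (\<psi> x) \<le> u)"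
      by fast
    also have "\<dots> \<longleftrightarrow> (\<forall>(a, x)\<in>set (pres_bind star ps g). star a (\<psi> x) \<le> u)"
      unfolding pres_bind_def by fastforce
    finally show ?thesis
      using pres_max_le_iff[OF assms(1)] pres_max_le_iff[OF ne] by simp
  qed
  then show ?thesis
    by (meson order.antisym order.refl)
qed

text \<open>By monotonicity an entry with the largest coefficient attains the maximum; that
  coefficient is \<open>e\<close>, which is neutral.\<close>

lemma pres_max_const:
  assumes "ps \<in> presentations e X"
  shows "pres_max star ps (\<lambda>x. c) = c"
proof -
  have ne: "ps \<noteq> []" and mx: "Max (fst ` set ps) = e"
    using assms by (auto simp: presentations_def)
  have "mono (\<lambda>a. star a c)"
    by (simp add: monoI star_mono)
  then have "star (Max (fst ` set ps)) c = Max ((\<lambda>a. star a c) ` fst ` set ps)"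
    using ne by (intro mono_Max_commute) auto
  then show ?thesis
    by (simp add: mx left_neutral pres_max_def image_image case_prod_unfold)
qed

text \<open>On the finite support the integrand lies between two real constants, and normalised
  measures reproduce constants.\<close>

lemma pres_max_finite:
  assumes "ps \<in> presentations e X"
  shows "\<bar>pres_max star ps (\<lambda>x. ereal (\<phi> x))\<bar> \<noteq> \<infinity>"
proof -
  have ne: "ps \<noteq> []"
    using assms by (auto simp: presentations_def)
  define F where "F = \<phi> ` snd ` set ps"
  have F: "finite F" "F \<noteq> {}"
    using ne by (auto simp: F_def)
  have mono: "pres_max star ps \<psi> \<le> pres_max star ps \<psi>'"
    if le: "\<And>x. x \<in> snd ` set ps \<Longrightarrow> \<psi> x \<le> \<psi>' x" for \<psi> \<psi>'
  proof -
    have "star a (\<psi> x) \<le> pres_max star ps \<psi>'" if *: "(a, x) \<in> set ps" for a x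
    proof -
      have "star a (\<psi> x) \<le> star a (\<psi>' x)"
        using * by (intro star_mono order.refl le) force
      also have "\<dots> \<le> pres_max star ps \<psi>'"
        unfolding pres_max_def using * by (intro Max_ge) force+
      finally show ?thesis .
    qed
    then show ?thesis
      by (auto simp: pres_max_le_iff[OF ne])
  qed
  have "pres_max star ps (\<lambda>x. ereal (\<phi> x)) \<le> pres_max star ps (\<lambda>x. ereal (Max F))"
    using F by (intro mono) (auto simp: F_def)
  moreover have "pres_max star ps (\<lambda>x. ereal (Min F)) \<le> pres_max star ps (\<lambda>x. ereal (\<phi> x))"
    using F by (intro mono) (auto simp: F_def)
  ultimately show ?thesis
    unfolding pres_max_const[OF assms] by auto
qed

section \<open>Equality and distance of measures on a discrete space\<close>

lemma ereal_measure_of_pres: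
  assumes "unit_discrete X" "ps \<in> presentations e X"
  shows "ereal (measure_of_pres star X ps \<phi>) = pres_max star ps (\<lambda>x. ereal (\<phi> x))"
  using pres_max_finite[OF assms(2)] by (simp add: measure_of_pres_discrete[OF assms(1)] ereal_real)

lemma measure_of_pres_eq_iff:
  assumes "unit_discrete X" "ps \<in> presentations e X" "qs \<in> presentations e X"
  shows "measure_of_pres star X ps = measure_of_pres star X qs \<longleftrightarrow>
    (\<forall>\<phi>. pres_max star ps (\<lambda>x. ereal (\<phi> x)) = pres_max star qs (\<lambda>x. ereal (\<phi> x)))"
  using ereal_measure_of_pres[OF assms(1,2)] ereal_measure_of_pres[OF assms(1,3)]
  by (metis ereal.inject ext)

lemma dhat_discrete:
  assumes X: "unit_discrete X" and mem: "\<mu> \<in> fin_measures star e X" "\<nu> \<in> fin_measures star e X"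
  shows "dhat X \<mu> \<nu> = (if \<mu> = \<nu> then 0 else 1)"
proof -
  have small: "\<phi> \<in> ball_const_funs X r" if "r \<le> 1" for \<phi> r
    using X that unfolding ball_const_funs_def unit_discrete_def by (fastforce split: if_splits)
  have const: "\<exists>c. \<forall>\<mu>\<in>fin_measures star e X. \<mu> \<phi> = c" if "1 < r" "\<phi> \<in> ball_const_funs X r" for \<phi> r
  proof -
    have *: "\<phi> x = \<phi> y" if "x \<in> mspace X" "y \<in> mspace X" for x y
    proof -
      have "mdist X y x < r"
        using X \<open>1 < r\<close> that by (simp add: unit_discrete_def)
      then show ?thesis
        using \<open>\<phi> \<in> _\<close> that by (simp add: ball_const_funs_def)
    qed
    obtain c where c: "\<And>x. x \<in> mspace X \<Longrightarrow> \<phi> x = c"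
      using * by metis
    have "measure_of_pres star X ps \<phi> = c" if ps: "ps \<in> presentations e X" for ps
    proof -
      have "pres_max star ps (\<lambda>x. ereal (\<phi> x)) = pres_max star ps (\<lambda>x. ereal c)"
        using ps c by (intro pres_max_cong) (auto simp: presentations_def)
      then show ?thesis
        using ereal_measure_of_pres[OF X ps, of \<phi>] pres_max_const[OF ps] by simp
    qed
    then show ?thesis
      by (auto simp: fin_measures_def)
  qed
  have "{r. r > 0 \<and> (\<forall>\<phi>\<in>ball_const_funs X r. \<mu> \<phi> = \<nu> \<phi>)} = (if \<mu> = \<nu> then {0<..} else {1<..})"
  proof (cases "\<mu> = \<nu>")
    case False
    then obtain \<phi> where "\<mu> \<phi> \<noteq> \<nu> \<phi>"
      by blast
    then have "\<not> r \<le> 1" if "\<forall>\<phi>\<in>ball_const_funs X r. \<mu> \<phi> = \<nu> \<phi>" for r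
      using small that by blast
    moreover have "\<mu> \<phi> = \<nu> \<phi>" if "1 < r" "\<phi> \<in> ball_const_funs X r" for r \<phi>
      using const[OF that] mem by metis
    ultimately show ?thesis
      using False by force
  qed auto
  then show ?thesis
    by (simp add: dhat_def)
qed

text \<open>Injectivity of \<open>code\<close> transports \<open>dhat_discrete\<close> to names.
  Discreteness of the result lets the construction be iterated.\<close>

lemma meas_obj_discrete:
  fixes X :: "'u metric"
  assumes universe: "(UNIV :: real set) \<lesssim> (UNIV :: 'u set)" and X: "unit_discrete X"
  shows "mspace (meas_obj star e X) = code (fin_measures star e X) ` fin_measures star e X"
    and "unit_discrete (meas_obj star e X)"
proof -
  let ?A = "fin_measures star e X"
  let ?P = "code ?A ` ?A :: 'u set"
  let ?d = "\<lambda>p q. if p \<in> ?P \<and> q \<in> ?P then dhat X (decode ?A p) (decode ?A q) else 0"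
  note inj = inj_on_code[OF universe, of star e X]
  have d: "?d p q = (if p \<in> ?P \<and> q \<in> ?P \<and> p \<noteq> q then 1 else 0)" for p q
    using dhat_discrete[OF X] inv_into_f_f[OF inj] by (auto simp: decode_def)
  show "mspace (meas_obj star e X) = ?P" "unit_discrete (meas_obj star e X)"
    unfolding meas_obj_def Let_def using unit_discrete_metric[of ?d ?P] d by auto
qed

section \<open>Names of measures, and the monad structure computed on presentations\<close>

lemma pt_in_meas_obj:
  fixes X :: "'u metric"
  assumes "(UNIV :: real set) \<lesssim> (UNIV :: 'u set)" "unit_discrete X" "ps \<in> presentations e X"
  shows "pt star e X ps \<in> mspace (meas_obj star e X)"
  using assms by (simp add: meas_obj_discrete pt_def fin_measures_pres)

lemma pt_eq_iff:
  fixes X :: "'u metric"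
  assumes "(UNIV :: real set) \<lesssim> (UNIV :: 'u set)" "ps \<in> presentations e X" "qs \<in> presentations e X"
  shows "pt star e X ps = pt star e X qs \<longleftrightarrow> measure_of_pres star X ps = measure_of_pres star X qs"
  using inj_on_eq_iff[OF inj_on_code[OF assms(1)]] assms(2,3)
  by (simp add: pt_def fin_measures_pres)

lemma pres_correct:
  fixes X :: "'u metric"
  assumes "(UNIV :: real set) \<lesssim> (UNIV :: 'u set)" "unit_discrete X" "p \<in> mspace (meas_obj star e X)"
  shows "pres star e X p \<in> presentations e X" "pt star e X (pres star e X p) = p"
proof -
  have "\<exists>ps. ps \<in> presentations e X \<and> pt star e X ps = p"
    using assms by (auto simp: meas_obj_discrete pt_def fin_measures_def)
  from someI_ex[OF this] show "pres star e X p \<in> presentations e X" "pt star e X (pres star e X p) = p"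
    by (simp_all add: pres_def)
qed

lemma pt_eqI:
  assumes "unit_discrete X"
    and "\<And>\<phi> :: _ \<Rightarrow> real. pres_max star ps (\<lambda>x. ereal (\<phi> x)) = pres_max star qs (\<lambda>x. ereal (\<phi> x))"
  shows "pt star e X ps = pt star e X qs"
  by (simp add: pt_def measure_of_pres_discrete assms)

text \<open>The chosen list may differ from \<open>ps\<close>, but both present the same
  functional.\<close>

lemma pres_pt:
  fixes X :: "'u metric"
  assumes "(UNIV :: real set) \<lesssim> (UNIV :: 'u set)" "unit_discrete X" "ps \<in> presentations e X"
  shows "pres_max star (pres star e X (pt star e X ps)) (\<lambda>x. ereal (\<phi> x)) =
    pres_max star ps (\<lambda>x. ereal (\<phi> x))"
proof -
  note pres = pres_correct[OF assms(1,2) pt_in_meas_obj[OF assms]]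
  from pres pt_eq_iff[OF assms(1) pres(1) assms(3)]
  show ?thesis
    by (simp add: measure_of_pres_eq_iff[OF assms(2) pres(1) assms(3)])
qed

text \<open>The image measure at a function is the original measure at its composite with
  \<open>f\<close>, so only the functional given by \<open>ps\<close> matters.\<close>

lemma meas_arr_pt:
  fixes X Y :: "'u metric"
  assumes "(UNIV :: real set) \<lesssim> (UNIV :: 'u set)" "unit_discrete X" "unit_discrete Y"
    and "ps \<in> presentations e X"
  shows "meas_arr star e X Y f (pt star e X ps) = pt star e Y (map (\<lambda>(a, x). (a, f x)) ps)"
  unfolding meas_arr_def
  by (rule pt_eqI[OF assms(3)])
    (simp add: pres_max_map pres_pt[OF assms(1,2,4), of "_ \<circ> f", simplified comp_def] comp_def)

text \<open>
  The multiplication is defined through arbitrarily chosen presentations. They do not matter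
  because \<open>\<mu> \<mapsto> \<mu>(\<phi>)\<close> is a continuous function on the space of measures, so that two presentations of
  the same measure of measures give it the same value.
\<close>

lemma meas_mult_bind:
  fixes X :: "'u metric"
  assumes universe: "(UNIV :: real set) \<lesssim> (UNIV :: 'u set)" and X: "unit_discrete X"
    and Y: "qs \<in> presentations e Y"
    and g: "\<And>z. z \<in> mspace Y \<Longrightarrow> g z \<in> presentations e X"
    and h: "\<And>z. z \<in> mspace Y \<Longrightarrow> h z = pt star e X (g z)"
  shows "meas_mult star e X (pt star e (meas_obj star e X) (map (\<lambda>(a, z). (a, h z)) qs)) =
    pt star e X (pres_bind star qs g)"
proof -
  define T where "T = meas_obj star e X"
  define ms where "ms = map (\<lambda>(a, z). (a, h z)) qs"
  define ns where "ns = pres star e T (pt star e T ms)"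
  have T: "unit_discrete T"
    unfolding T_def by (rule meas_obj_discrete(2)[OF universe X])
  have "h \<in> mspace Y \<rightarrow> mspace T"
    using pt_in_meas_obj[OF universe X] g h by (auto simp: T_def)
  then have ms: "ms \<in> presentations e T"
    unfolding ms_def by (rule presentations_map[OF Y])
  have ns: "ns \<in> presentations e T"
    unfolding ns_def T_def
    using pres_correct(1)[OF universe T] pt_in_meas_obj[OF universe T ms] by (simp add: T_def)
  have pres_ne: "pres star e X m \<noteq> []" if "m \<in> mspace T" for m
    using pres_correct(1)[OF universe X] that by (auto simp: T_def presentations_def)
  have qs: "qs \<noteq> []" "snd ` set qs \<subseteq> mspace Y"
    using Y by (auto simp: presentations_def)
  have "pres_max star (pres_bind star ns (pres star e X)) (\<lambda>x. ereal (\<phi> x)) =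
      pres_max star (pres_bind star qs g) (\<lambda>x. ereal (\<phi> x))" for \<phi>
  proof -
    define \<psi> where "\<psi> m = measure_of_pres star X (pres star e X m) \<phi>" for m
    have \<psi>: "ereal (\<psi> m) = pres_max star (pres star e X m) (\<lambda>x. ereal (\<phi> x))" if "m \<in> mspace T" for m
      unfolding \<psi>_def using pres_correct(1)[OF universe X] that
      by (simp add: T_def ereal_measure_of_pres[OF X])
    have "pres_max star (pres_bind star ns (pres star e X)) (\<lambda>x. ereal (\<phi> x)) =
        pres_max star ns (\<lambda>m. pres_max star (pres star e X m) (\<lambda>x. ereal (\<phi> x)))"
      using ns pres_ne by (intro pres_max_bind) (auto simp: presentations_def)
    also have "\<dots> = pres_max star ns (\<lambda>m. ereal (\<psi> m))"
      using ns \<psi> by (intro pres_max_cong) (auto simp: presentations_def)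
    \<comment> \<open>Here the chosen presentation \<open>ns\<close> is traded for
      \<open>ms\<close>. \<open>pres_pt\<close> tests real-valued functions only, hence the detour
      through \<open>\<psi>\<close>.\<close>
    also have "\<dots> = pres_max star ms (\<lambda>m. ereal (\<psi> m))"
      unfolding ns_def by (rule pres_pt[OF universe T ms])
    also have "\<dots> = pres_max star qs (\<lambda>z. ereal (\<psi> (h z)))"
      by (simp add: ms_def pres_max_map comp_def)
    also have "\<dots> = pres_max star qs (\<lambda>z. pres_max star (g z) (\<lambda>x. ereal (\<phi> x)))"
    proof (rule pres_max_cong)
      fix z assume "z \<in> snd ` set qs"
      then have z: "z \<in> mspace Y"
        using qs by auto
      then show "ereal (\<psi> (h z)) = pres_max star (g z) (\<lambda>x. ereal (\<phi> x))"
        using \<open>h \<in> _\<close> \<psi> pres_pt[OF universe X g[OF z]] h by (auto simp: Pi_iff)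
    qed
    also have "\<dots> = pres_max star (pres_bind star qs g) (\<lambda>x. ereal (\<phi> x))"
      using qs g by (intro pres_max_bind[symmetric]) (auto simp: presentations_def)
    finally show ?thesis .
  qed
  from pt_eqI[OF X this] show ?thesis
    by (simp add: meas_mult_def pres_bind_def ns_def ms_def T_def)
qed

lemma meas_unit_pt:
  assumes "unit_discrete X"
  shows "meas_unit star e X x = pt star e X [(e, x)]"
  by (simp add: meas_unit_def pt_def dirac_def measure_of_pres_def unit_discrete_cont_funs[OF assms]
      left_neutral)

end

section \<open>The two monads\<close>

interpretation I: coefficient_op "(+)" 0
  by unfold_locales (auto simp: add.assoc add_mono)

interpretation J: coefficient_op min \<infinity>
  by unfold_locales (auto simp: min.assoc min.coboundedI1 min.coboundedI2)

lemma monad_sel [simp]: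
  "obj I_monad = meas_obj (+) 0" "arr I_monad = meas_arr (+) 0"
  "unit I_monad = meas_unit (+) 0" "mult I_monad = meas_mult (+) 0"
  "obj J_monad = meas_obj min \<infinity>" "arr J_monad = meas_arr min \<infinity>"
  "unit J_monad = meas_unit min \<infinity>" "mult J_monad = meas_mult min \<infinity>"
  by (simp_all add: I_monad_def J_monad_def meas_monad_def)

section \<open>Contradiction on a two-point space\<close>

theorem theorem4p9:
  assumes universe: "(UNIV :: real set) \<lesssim> (UNIV :: 'u set)"
  shows "\<not> (\<exists>\<alpha>. natural_isomorphism (I_monad :: 'u umet_monad) (J_monad :: 'u umet_monad) \<alpha> \<and>
               monad_morphism (I_monad :: 'u umet_monad) (J_monad :: 'u umet_monad) \<alpha>)"
proof
  assume "\<exists>\<alpha>. natural_isomorphism (I_monad :: 'u umet_monad) J_monad \<alpha> \<and>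
               monad_morphism (I_monad :: 'u umet_monad) J_monad \<alpha>"
  then obtain \<alpha> where iso: "natural_isomorphism (I_monad :: 'u umet_monad) J_monad \<alpha>"
    and mor: "monad_morphism (I_monad :: 'u umet_monad) J_monad \<alpha>"
    by blast
  have "\<exists>x y :: 'u. x \<noteq> y"
    using universe by (auto simp: lepoll_def dest!: inj_onD[of _ _ 0 1])
  then obtain x y :: 'u where xy: "x \<noteq> y"
    by blast
  define X where "X = metric ({x, y}, \<lambda>a b. if a \<in> {x, y} \<and> b \<in> {x, y} \<and> a \<noteq> b then 1 else 0)"
  have mX: "mspace X = {x, y}" and X: "unit_discrete X"
    unfolding X_def by (rule unit_discrete_metric; rule refl)+
  define IX where "IX = meas_obj (+) 0 X"
  define JX where "JX = meas_obj min \<infinity> X"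
  have IX: "unit_discrete IX" and JX: "unit_discrete JX"
    unfolding IX_def JX_def
    by (rule I.meas_obj_discrete[OF universe X] J.meas_obj_discrete[OF universe X])+
  have \<alpha>_in: "\<alpha> Y \<in> mspace (meas_obj (+) 0 Y) \<rightarrow> mspace (meas_obj min \<infinity> Y)" if "unit_discrete Y" for Y
    using iso unit_discrete_ultrametric[OF that]
    by (simp add: natural_isomorphism_def natural_transformation_def nonexpanding_def)
  have \<alpha>_inj: "inj_on (\<alpha> X) (mspace IX)"
  proof -
    have "umet_isomorphism IX JX (\<alpha> X)"
      using iso unit_discrete_ultrametric[OF X] by (simp add: natural_isomorphism_def IX_def JX_def)
    then obtain g where "\<forall>p\<in>mspace IX. g (\<alpha> X p) = p"
      unfolding umet_isomorphism_def by blast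
    then show ?thesis
      by (auto intro: inj_on_inverseI[of _ g])
  qed
  define ms :: "(ereal \<times> 'u) list" where "ms = [(0, x), (ereal (-1), y)]"
  \<comment> \<open>The dominated entry at \<open>x\<close> with coefficient -1 comes from
    substituting \<open>ms\<close> for \<open>y\<close>; keeping it makes \<open>ns\<close>
    literally the list that \<open>pres_bind\<close> returns.\<close>
  define ns :: "(ereal \<times> 'u) list" where "ns = [(0, x), (ereal (-1), x), (ereal (-2), y)]"
  have ms: "ms \<in> presentations 0 X" and ns: "ns \<in> presentations 0 X"
    and dx: "[(0, x)] \<in> presentations 0 X" "[(\<infinity>, x)] \<in> presentations \<infinity> X"
    by (auto simp: ms_def ns_def presentations_def mX)
  define \<mu> where "\<mu> = pt (+) 0 X ms"
  define f where "f z = (if z = x then pt (+) 0 X [(0, x)] else \<mu>)" for z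
  define q where "q = \<alpha> X \<mu>"
  define qs where "qs = pres min \<infinity> X q"
  have \<mu>: "\<mu> \<in> mspace IX"
    unfolding \<mu>_def IX_def by (rule I.pt_in_meas_obj[OF universe X ms])
  have f: "f \<in> mspace X \<rightarrow> mspace IX"
    using \<mu> I.pt_in_meas_obj[OF universe X dx(1)] by (auto simp: f_def IX_def)
  have q: "q \<in> mspace JX"
    using \<alpha>_in[OF X] \<mu> by (auto simp: q_def IX_def JX_def)
  have qs: "qs \<in> presentations \<infinity> X" "pt min \<infinity> X qs = q"
    using J.pres_correct[OF universe X] q by (simp_all add: qs_def JX_def)
  define M where "M = meas_arr (+) 0 X IX f \<mu>"
  have M_eq: "M = pt (+) 0 IX (map (\<lambda>(a, z). (a, f z)) ms)"
    unfolding M_def \<mu>_def by (rule I.meas_arr_pt[OF universe X IX ms])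
  have M: "M \<in> mspace (meas_obj (+) 0 IX)"
    unfolding M_eq by (rule I.pt_in_meas_obj[OF universe IX presentations_map[OF ms f]])

  have "meas_mult (+) 0 X M =
      pt (+) 0 X (pres_bind (+) ms (\<lambda>z. if z = x then [(0, x)] else ms))"
    unfolding M_eq IX_def
    by (rule I.meas_mult_bind[OF universe X ms]) (auto simp: dx ms f_def \<mu>_def)
  also have "pres_bind (+) ms (\<lambda>z. if z = x then [(0, x)] else ms) = ns"
    using xy by (simp add: pres_bind_def ms_def ns_def)
  finally have multM: "meas_mult (+) 0 X M = pt (+) 0 X ns" .

  \<comment> \<open>Naturality at \<open>f\<close>, regarded as a map from \<open>X\<close> into its
    space of measures, evaluated at \<open>\<mu>\<close>.\<close>
  have "\<alpha> IX M = meas_arr min \<infinity> X IX f q"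
  proof -
    have "natural_transformation (I_monad :: 'u umet_monad) J_monad \<alpha>"
      using iso by (simp add: natural_isomorphism_def)
    then show ?thesis
      using X IX \<mu> unit_discrete_nonexpanding[OF X IX f]
      by (simp add: natural_transformation_def unit_discrete_ultrametric M_def q_def flip: IX_def)
  qed
  also have "\<dots> = pt min \<infinity> IX (map (\<lambda>(a, z). (a, f z)) qs)"
    using J.meas_arr_pt[OF universe X IX qs(1)] qs(2) by simp
  finally have "meas_arr min \<infinity> IX JX (\<alpha> X) (\<alpha> IX M) =
      pt min \<infinity> JX (map (\<lambda>(a, z). (a, \<alpha> X z)) (map (\<lambda>(a, z). (a, f z)) qs))"
    using J.meas_arr_pt[OF universe IX JX presentations_map[OF qs(1) f]] by simp
  also have "map (\<lambda>(a, z). (a, \<alpha> X z)) (map (\<lambda>(a, z). (a, f z)) qs) =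
      map (\<lambda>(a, z). (a, \<alpha> X (f z))) qs"
    by auto
  finally have "meas_mult min \<infinity> X (meas_arr min \<infinity> IX JX (\<alpha> X) (\<alpha> IX M)) =
      meas_mult min \<infinity> X (pt min \<infinity> JX (map (\<lambda>(a, z). (a, \<alpha> X (f z))) qs))"
    by simp
  \<comment> \<open>After \<open>f\<close>, the component \<open>\<alpha> X\<close> takes
    \<open>x\<close> to its Dirac measure, by the unit law, and \<open>y\<close> to
    \<open>q\<close>. The coefficients in \<open>qs\<close> remain unknown.\<close>
  also have "\<dots> = pt min \<infinity> X (pres_bind min qs (\<lambda>z. if z = x then [(\<infinity>, x)] else qs))"
    unfolding JX_def
  proof (rule J.meas_mult_bind[OF universe X qs(1)])
    have "\<alpha> X (meas_unit (+) 0 X x) = meas_unit min \<infinity> X x"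
      using mor unit_discrete_ultrametric[OF X] by (simp add: monad_morphism_def mX)
    then show "\<alpha> X (f z) = pt min \<infinity> X (if z = x then [(\<infinity>, x)] else qs)" for z
      by (simp add: f_def qs(2) q_def I.meas_unit_pt[OF X] J.meas_unit_pt[OF X])
  qed (auto simp: dx qs)
  also have "\<dots> = pt min \<infinity> X qs"
  proof (rule J.pt_eqI[OF X])
    fix \<phi> :: "'u \<Rightarrow> real"
    let ?\<psi> = "\<lambda>z. ereal (\<phi> z)"
    have qs_ne: "qs \<noteq> []"
      using qs(1) by (auto simp: presentations_def)
    have "pres_max min (pres_bind min qs (\<lambda>z. if z = x then [(\<infinity>, x)] else qs)) ?\<psi> =
        pres_max min qs (\<lambda>z. pres_max min (if z = x then [(\<infinity>, x)] else qs) ?\<psi>)"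
      using qs_ne by (intro J.pres_max_bind) auto
    also have "\<dots> = pres_max min qs ?\<psi>"
    proof (rule order.antisym)
      have ge: "min a (?\<psi> z) \<le> pres_max min qs ?\<psi>" if "(a, z) \<in> set qs" for a z
        unfolding pres_max_def using that by (intro Max_ge) force+
      have single: "pres_max min [(\<infinity>, x)] ?\<psi> = ?\<psi> x"
        by (simp add: pres_max_def)
      \<comment> \<open>A term with \<open>z = x\<close> already occurs in the right-hand maximum;
        any other term is a minimum with that maximum itself.\<close>
      show "pres_max min qs (\<lambda>z. pres_max min (if z = x then [(\<infinity>, x)] else qs) ?\<psi>) \<le> pres_max min qs ?\<psi>"
        using ge single by (auto simp: pres_max_le_iff[OF qs_ne] min.coboundedI2)
      have "min a (?\<psi> z) \<le> pres_max min qs (\<lambda>z. pres_max min (if z = x then [(\<infinity>, x)] else qs) ?\<psi>)"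
        if az: "(a, z) \<in> set qs" for a z
      proof -
        \<comment> \<open>For \<open>z\<close> other than \<open>x\<close>, the left side is at most
          \<open>a\<close> and, as a term of the maximum over \<open>qs\<close>, at most that
          maximum; hence it is below their minimum.\<close>
        have "min a (?\<psi> z) \<le> min a (pres_max min (if z = x then [(\<infinity>, x)] else qs) ?\<psi>)"
          using ge[OF az] single by auto
        also have "\<dots> \<le> pres_max min qs (\<lambda>z. pres_max min (if z = x then [(\<infinity>, x)] else qs) ?\<psi>)"
          unfolding pres_max_def[of _ qs "\<lambda>z. pres_max min (if z = x then [(\<infinity>, x)] else qs) ?\<psi>"]
          using az by (intro Max_ge) force+
        finally show ?thesis .
      qed
      then show "pres_max min qs ?\<psi> \<le> pres_max min qs (\<lambda>z. pres_max min (if z = x then [(\<infinity>, x)] else qs) ?\<psi>)"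
        by (auto simp: pres_max_le_iff[OF qs_ne])
    qed
    finally show "pres_max min (pres_bind min qs (\<lambda>z. if z = x then [(\<infinity>, x)] else qs)) ?\<psi> =
        pres_max min qs ?\<psi>" .
  qed
  finally have "meas_mult min \<infinity> X (meas_arr min \<infinity> IX JX (\<alpha> X) (\<alpha> IX M)) = \<alpha> X \<mu>"
    by (simp add: qs(2) q_def)
  moreover have "meas_mult min \<infinity> X (meas_arr min \<infinity> IX JX (\<alpha> X) (\<alpha> IX M)) = \<alpha> X (meas_mult (+) 0 X M)"
    using mor unit_discrete_ultrametric[OF X] M by (simp add: monad_morphism_def IX_def JX_def)
  ultimately have "\<alpha> X (pt (+) 0 X ns) = \<alpha> X (pt (+) 0 X ms)"
    by (simp add: multM \<mu>_def)
  then have "pt (+) 0 X ns = pt (+) 0 X ms"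
    using inj_onD[OF \<alpha>_inj] I.pt_in_meas_obj[OF universe X] ms ns by (simp add: IX_def)
  \<comment> \<open>With value 0 at \<open>x\<close> and c > 1 at \<open>y\<close>,
    \<open>ms\<close> gives c - 1 and \<open>ns\<close> gives max 0 (c - 2); for c = 5 these are 4
    and 3.\<close>
  then have "measure_of_pres (+) X ns (\<lambda>z. if z = x then 0 else 5) =
      measure_of_pres (+) X ms (\<lambda>z. if z = x then 0 else 5)"
    by (simp add: I.pt_eq_iff[OF universe ns ms])
  then have "pres_max (+) ns (\<lambda>z. ereal (if z = x then 0 else 5)) =
      pres_max (+) ms (\<lambda>z. ereal (if z = x then 0 else 5))"
    using I.ereal_measure_of_pres[OF X ns] I.ereal_measure_of_pres[OF X ms] by metis
  then show False
    using xy by (simp add: pres_max_def ms_def ns_def)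
qed

end
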